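(* Let $ABCD$ be a plane quadrilateral and let $\ell>0$. If $ABCD$ is not a Darboux butterfly, let $C_1\ni A,C$ and $C_2\ni B,D$ be the associated concentric circles of radii $r_1\ge r_2$ (or parallel lines, in which case $r_1-r_2$ denotes the distance between them and $r_1+r_2=\infty$). Then the discrete bicycle monodromy about the quadrilateral with length parameter $\ell$ is elliptic for $\ell\in(0,r_1-r_2)\cup(r_1+r_2,\infty)$, hyperbolic for $\ell\in(r_1-r_2,r_1+r_2)$, and parabolic for $\ell=r_1\pm r_2$. For $\ell$ in the hyperbolic or parabolic range, the discrete bicycle correspondence is induced by a point $A'\in C_2$: the closed quadrilaterals $A'B'C'D'$ in the discrete bicycle correspondence with $ABCD$ with length parameter $\ell$ are exactly those obtained by transporting a point $A'\in C_2$ with $|AA'|=\ell$ along $ABCD$, and they satisfy $A',C'\in C_2$, $B',D'\in C_1$. If $ABCD$ is a Darboux butterfly, then the monodromy is the identity. For every starting point $A'$ with $|AA'|=\ell$, there exist concentric circles (or parallel lines) $C_1\ni A,C$ and $C_2\ni B,D$ such that $C_2$ passes through $A'$, and the corresponding quadrilateral $A'B'C'D'$ is again closed with $A',C'\in C_2$, $B',D'\in C_1$.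
   Context: Quadrilaterals are closed polygons in $\mathbb{R}^2$ with four distinct vertices (not necessarily simple). Darboux butterfly: a closed quadrilateral $P_1P_2P_3P_4$ formed by the lateral sides and diagonals of an isosceles trapezoid with bases $P_1P_3$ and $P_2P_4$; that is, there is a line such that the reflection in it interchanges $P_1\leftrightarrow P_3$ and $P_2\leftrightarrow P_4$ (degenerate collinear trapezoids are allowed). The circles $C_1,C_2$ for a quadrilateral $ABCD$ that is not a Darboux butterfly: if the diagonals $AC$ and $BD$ are not parallel, let $O$ be the intersection point of the perpendicular bisectors of $AC$ and $BD$; $C_1$ is the circle centered at $O$ through $A$ and $C$, $C_2$ is the circle centered at $O$ through $B$ and $D$, and the vertices are labeled so that their radii satisfy $r_1\ge r_2$. If $AC$ and $BD$ are parallel, $C_1$ and $C_2$ are the parallel lines $AC$ and $BD$. Discrete bicycle transport. Let $P,Q\in\mathbb{R}^2$, $\ell>0$, $\ell\ne|PQ|$, $|PX|=\ell$. Translate $X$ along $\overrightarrow{PQ}$ to $U=X+Q-P$ and reflect $U$ in the line $XQ$ to obtain $Y$, the transport of $X$ along $PQ$; then $|QY|=\ell$. In terms of $u=(X-P)/\ell$, $v=(Y-Q)/\ell$: $v=\frac{2\,u\cdot\xi}{|\xi|^2}\xi-u$ with $\xi=(Q-P)-\ell u$; this defines $m_{PQ,\ell}:S^1\to S^1$. The monodromy about $ABCD$ is $m_{DA,\ell}\circ m_{CD,\ell}\circ m_{BC,\ell}\circ m_{AB,\ell}$, a fractional-linear transformation of $S^1\cong\mathbb{RP}^1$; it is called elliptic,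 parabolic, or hyperbolic if it has no, exactly one, or exactly two fixed points, respectively. Given $A'$ with $|AA'|=\ell$, the points $B',C',D'$ are the consecutive transports along $AB$, $BC$, $CD$; the quadrilateral $A'B'C'D'$ is closed if the transport of $D'$ along $DA$ is $A'$, in which case it is in the discrete bicycle correspondence with $ABCD$. The parameter $\ell$ is taken different from all side lengths of the quadrilateral. *)

theory Defs
  imports "HOL-Analysis.Analysis"
begin

section \<open>Quadrilaterals in the plane and their circles\<close>

definition quadrilateral :: "real^2 \<Rightarrow> real^2 \<Rightarrow> real^2 \<Rightarrow> real^2 \<Rightarrow> bool" where
  "quadrilateral A B C D \<longleftrightarrow> distinct [A, B, C, D]"

definition line :: "real^2 \<Rightarrow> real^2 \<Rightarrow> (real^2) set" where
  "line P Q = affine hull {P, Q}"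

definition is_line :: "(real^2) set \<Rightarrow> bool" where
  "is_line L \<longleftrightarrow> affine L \<and> aff_dim L = 1"

definition reflection :: "(real^2) set \<Rightarrow> real^2 \<Rightarrow> real^2" where
  "reflection L X = 2 *\<^sub>R closest_point L X - X"

definition darboux_butterfly :: "real^2 \<Rightarrow> real^2 \<Rightarrow> real^2 \<Rightarrow> real^2 \<Rightarrow> bool" where
  "darboux_butterfly A B C D \<longleftrightarrow>
     (\<exists>L. is_line L \<and> reflection L A = C \<and> reflection L C = A
                    \<and> reflection L B = D \<and> reflection L D = B)"

definition perp_bisector :: "real^2 \<Rightarrow> real^2 \<Rightarrow> (real^2) set" where
  "perp_bisector P Q = {X. (X - midpoint P Q) \<bullet> (Q - P) = 0}"

text \<open>Equal lines count as parallel, so collinear quadrilaterals have parallel diagonals.\<close>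

definition parallel_diagonals :: "real^2 \<Rightarrow> real^2 \<Rightarrow> real^2 \<Rightarrow> real^2 \<Rightarrow> bool" where
  "parallel_diagonals A B C D \<longleftrightarrow> affine_parallel (line A C) (line B D)"

text \<open>The centre is meaningful only for non-parallel diagonals; see \<open>ex1_center\<close>.\<close>

definition center :: "real^2 \<Rightarrow> real^2 \<Rightarrow> real^2 \<Rightarrow> real^2 \<Rightarrow> real^2" where
  "center A B C D = (THE X. X \<in> perp_bisector A C \<and> X \<in> perp_bisector B D)"

definition radius1 :: "real^2 \<Rightarrow> real^2 \<Rightarrow> real^2 \<Rightarrow> real^2 \<Rightarrow> real" where
  "radius1 A B C D = dist (center A B C D) A"

definition radius2 :: "real^2 \<Rightarrow> real^2 \<Rightarrow> real^2 \<Rightarrow> real^2 \<Rightarrow> real" where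
  "radius2 A B C D = dist (center A B C D) B"

definition circle1 :: "real^2 \<Rightarrow> real^2 \<Rightarrow> real^2 \<Rightarrow> real^2 \<Rightarrow> (real^2) set" where
  "circle1 A B C D = (if parallel_diagonals A B C D then line A C
                      else sphere (center A B C D) (radius1 A B C D))"

definition circle2 :: "real^2 \<Rightarrow> real^2 \<Rightarrow> real^2 \<Rightarrow> real^2 \<Rightarrow> (real^2) set" where
  "circle2 A B C D = (if parallel_diagonals A B C D then line B D
                      else sphere (center A B C D) (radius2 A B C D))"

definition radius_diff :: "real^2 \<Rightarrow> real^2 \<Rightarrow> real^2 \<Rightarrow> real^2 \<Rightarrow> ereal" where
  "radius_diff A B C D = (if parallel_diagonals A B C D then ereal (setdist (line A C) (line B D))
                          else ereal (radius1 A B C D - radius2 A B C D))"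

definition radius_sum :: "real^2 \<Rightarrow> real^2 \<Rightarrow> real^2 \<Rightarrow> real^2 \<Rightarrow> ereal" where
  "radius_sum A B C D = (if parallel_diagonals A B C D then \<infinity>
                         else ereal (radius1 A B C D + radius2 A B C D))"

text \<open>The two members of such a pair may coincide.\<close>

definition concentric_or_parallel :: "(real^2) set \<Rightarrow> (real^2) set \<Rightarrow> bool" where
  "concentric_or_parallel C1 C2 \<longleftrightarrow>
     (\<exists>Z r s. r > 0 \<and> s > 0 \<and> C1 = sphere Z r \<and> C2 = sphere Z s) \<or>
     (is_line C1 \<and> is_line C2 \<and> affine_parallel C1 C2)"


section \<open>Discrete bicycle transport, monodromy and correspondence\<close>

definition transport :: "real^2 \<Rightarrow> real^2 \<Rightarrow> real^2 \<Rightarrow> real^2" where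
  "transport P Q X = reflection (line X Q) (X + Q - P)"

definition bicycle_map :: "real \<Rightarrow> real^2 \<Rightarrow> real^2 \<Rightarrow> real^2 \<Rightarrow> real^2" where
  "bicycle_map l P Q u =
     (let \<xi> = (Q - P) - l *\<^sub>R u in (2 * (u \<bullet> \<xi>) / (norm \<xi>)\<^sup>2) *\<^sub>R \<xi> - u)"

definition monodromy ::
    "real \<Rightarrow> real^2 \<Rightarrow> real^2 \<Rightarrow> real^2 \<Rightarrow> real^2 \<Rightarrow> real^2 \<Rightarrow> real^2" where
  "monodromy l A B C D =
     bicycle_map l D A \<circ> bicycle_map l C D \<circ> bicycle_map l B C \<circ> bicycle_map l A B"

text \<open>The monodromy acts on the unit circle \<open>sphere 0 1\<close>; only fixed points there count.\<close>

definition circle_fixpoints :: "(real^2 \<Rightarrow> real^2) \<Rightarrow> (real^2) set" where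
  "circle_fixpoints m = {u \<in> sphere 0 1. m u = u}"

definition elliptic :: "(real^2 \<Rightarrow> real^2) \<Rightarrow> bool" where
  "elliptic m \<longleftrightarrow> circle_fixpoints m = {}"

definition parabolic :: "(real^2 \<Rightarrow> real^2) \<Rightarrow> bool" where
  "parabolic m \<longleftrightarrow> card (circle_fixpoints m) = 1"

definition hyperbolic :: "(real^2 \<Rightarrow> real^2) \<Rightarrow> bool" where
  "hyperbolic m \<longleftrightarrow> card (circle_fixpoints m) = 2"

definition transports_along ::
    "real^2 \<Rightarrow> real^2 \<Rightarrow> real^2 \<Rightarrow> real^2 \<Rightarrow> real^2 \<Rightarrow> real^2 \<Rightarrow> real^2 \<Rightarrow> real^2 \<Rightarrow> bool" where
  "transports_along A B C D A' B' C' D' \<longleftrightarrow>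
     B' = transport A B A' \<and> C' = transport B C B' \<and> D' = transport C D C'"

definition bicycle_correspondence ::
    "real \<Rightarrow> real^2 \<Rightarrow> real^2 \<Rightarrow> real^2 \<Rightarrow> real^2 \<Rightarrow> real^2 \<Rightarrow> real^2 \<Rightarrow> real^2 \<Rightarrow> real^2 \<Rightarrow> bool" where
  "bicycle_correspondence l A B C D A' B' C' D' \<longleftrightarrow>
     dist A A' = l \<and> transports_along A B C D A' B' C' D' \<and> transport D A D' = A'"


section \<open>Coherence of the definitions\<close>

lemma line_altdef: "line P Q = range (\<lambda>t. P + t *\<^sub>R (Q - P))"
  by (simp add: line_def affine_hull_2_alt)

lemma reflection_line:
  assumes "P \<noteq> Q"
  shows "reflection (line P Q) X
         = P + (2 * ((X - P) \<bullet> (Q - P)) / (norm (Q - P))\<^sup>2) *\<^sub>R (Q - P) - (X - P)"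
proof -
  define w where "w = Q - P"
  define t where "t = ((X - P) \<bullet> w) / (w \<bullet> w)"
  have w: "w \<bullet> w \<noteq> 0" using assms by (simp add: w_def)
  have orth: "(X - (P + t *\<^sub>R w)) \<bullet> w = 0"
    using w by (simp add: t_def inner_diff_left inner_add_left)
  have "closest_point (line P Q) X = P + t *\<^sub>R w"
  proof (rule sym, rule closest_point_unique)
    show "convex (line P Q)" "closed (line P Q)"
      by (simp_all add: line_def affine_imp_convex)
    show "P + t *\<^sub>R w \<in> line P Q" unfolding line_altdef w_def by blast
    show "\<forall>z\<in>line P Q. dist X (P + t *\<^sub>R w) \<le> dist X z"
    proof
      fix z assume "z \<in> line P Q"
      then obtain s where z: "z = P + s *\<^sub>R w" by (auto simp: line_altdef w_def)
      have "X - z = (X - (P + t *\<^sub>R w)) + (t - s) *\<^sub>R w"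
        by (simp add: z algebra_simps)
      then have "(norm (X - z))\<^sup>2 = (norm (X - (P + t *\<^sub>R w)))\<^sup>2 + (norm ((t - s) *\<^sub>R w))\<^sup>2"
        using orth by (metis inner_scaleR_right mult_zero_right norm_add_Pythagorean orthogonal_def)
      then have "(norm (X - (P + t *\<^sub>R w)))\<^sup>2 \<le> (norm (X - z))\<^sup>2" by simp
      then show "dist X (P + t *\<^sub>R w) \<le> dist X z"
        by (simp add: dist_norm power2_le_iff_abs_le)
    qed
  qed
  moreover have "2 * ((X - P) \<bullet> w) / (norm w)\<^sup>2 = 2 * t"
    by (simp add: t_def power2_norm_eq_inner)
  ultimately show ?thesis
    unfolding reflection_def by (simp add: scaleR_add_right scaleR_2 flip: w_def)
qed

lemma transport_eq_bicycle_map: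
  assumes "dist P X = l" "l > 0" "dist P Q \<noteq> l"
  shows "transport P Q X = Q + l *\<^sub>R bicycle_map l P Q ((X - P) /\<^sub>R l)"
proof -
  define w where "w = Q - X"
  have "X \<noteq> Q" using assms by auto
  then have w: "(norm w)\<^sup>2 \<noteq> 0" by (simp add: w_def)
  define c where "c = 2 * ((X - P) \<bullet> w) / (norm w)\<^sup>2"
  have "(Q - P) \<bullet> w = (X - P) \<bullet> w + (norm w)\<^sup>2"
    by (simp add: w_def power2_norm_eq_inner flip: inner_add_left)
  then have "2 * ((Q - P) \<bullet> w) / (norm w)\<^sup>2 = c + 2"
    using w by (simp add: c_def field_simps)
  then have "transport P Q X = X + (c + 2) *\<^sub>R w - (Q - P)"
    using \<open>X \<noteq> Q\<close> by (simp add: transport_def reflection_line w_def)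
  also have "\<dots> = Q + (c *\<^sub>R w - (X - P))"
    by (simp add: w_def scaleR_add_left scaleR_2)
  also have "\<dots> = Q + l *\<^sub>R bicycle_map l P Q ((X - P) /\<^sub>R l)"
  proof -
    have "(Q - P) - l *\<^sub>R ((X - P) /\<^sub>R l) = w" using assms(2) by (simp add: w_def)
    moreover have "l * (2 * (((X - P) /\<^sub>R l) \<bullet> w) / (norm w)\<^sup>2) = c"
      using assms(2) by (simp add: c_def)
    ultimately show ?thesis
      using assms(2) unfolding bicycle_map_def Let_def by (simp add: scaleR_diff_right)
  qed
  finally show ?thesis .
qed

lemma ex1_center:
  assumes "quadrilateral A B C D" "\<not> parallel_diagonals A B C D"
  shows "\<exists>!X. X \<in> perp_bisector A C \<and> X \<in> perp_bisector B D"
proof -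
  define e f where "e = C - A" and "f = D - B"
  have ef: "e \<noteq> 0" "f \<noteq> 0" using assms(1) by (auto simp: e_def f_def quadrilateral_def)
  define d where "d = e$1 * f$2 - e$2 * f$1"
  have d: "d \<noteq> 0"
  proof
    assume "d = 0"
    then have "\<exists>k. f = k *\<^sub>R e"
    proof (cases "e$1 = 0")
      case True
      then have "e$2 \<noteq> 0" using ef by (auto simp: vec_eq_iff forall_2)
      with \<open>d = 0\<close> True show ?thesis
        by (intro exI[of _ "f$2 / e$2"]) (auto simp: vec_eq_iff forall_2 d_def)
    next
      case False
      with \<open>d = 0\<close> show ?thesis
        by (intro exI[of _ "f$1 / e$1"]) (auto simp: vec_eq_iff forall_2 d_def field_simps)
    qed
    then obtain k where k: "f = k *\<^sub>R e" by blast
    with ef have "k \<noteq> 0" by auto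
    have "line B D = (\<lambda>x. (B - A) + x) ` line A C"
    proof (intro equalityI subsetI)
      fix x assume "x \<in> line B D"
      then obtain t where "x = B + t *\<^sub>R f" unfolding line_altdef f_def by blast
      then have "x = (B - A) + (A + (t * k) *\<^sub>R (C - A))" by (simp add: k e_def)
      then show "x \<in> (\<lambda>x. (B - A) + x) ` line A C" unfolding line_altdef by blast
    next
      fix x assume "x \<in> (\<lambda>x. (B - A) + x) ` line A C"
      then obtain t where "x = (B - A) + (A + t *\<^sub>R e)"
        unfolding line_altdef e_def by blast
      then have "x = B + (t / k) *\<^sub>R (D - B)"
        using \<open>k \<noteq> 0\<close> k by (simp flip: f_def)
      then show "x \<in> line B D" unfolding line_altdef by blast
    qed
    with assms(2) show False unfolding parallel_diagonals_def affine_parallel_def by blast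
  qed
  define p q where "p = midpoint A C \<bullet> e" and "q = midpoint B D \<bullet> f"
  have iff: "X \<in> perp_bisector A C \<and> X \<in> perp_bisector B D
      \<longleftrightarrow> X$1 * e$1 + X$2 * e$2 = p \<and> X$1 * f$1 + X$2 * f$2 = q" for X
    by (auto simp: perp_bisector_def left_diff_distrib p_def q_def inner_vec_def sum_2
        simp flip: e_def f_def)
  have "X$1 * e$1 + X$2 * e$2 = p \<and> X$1 * f$1 + X$2 * f$2 = q
      \<longleftrightarrow> X = vector [(p * f$2 - q * e$2) / d, (e$1 * q - f$1 * p) / d]" for X :: "real^2"
  proof
    assume *: "X$1 * e$1 + X$2 * e$2 = p \<and> X$1 * f$1 + X$2 * f$2 = q"
    have "X$1 * d = p * f$2 - q * e$2" "X$2 * d = e$1 * q - f$1 * p"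
      using * by (auto simp: d_def algebra_simps)
    then show "X = vector [(p * f$2 - q * e$2) / d, (e$1 * q - f$1 * p) / d]"
      using d by (simp add: vec_eq_iff forall_2 field_simps)
  next
    assume "X = vector [(p * f$2 - q * e$2) / d, (e$1 * q - f$1 * p) / d]"
    then have X: "X$1 = (p * f$2 - q * e$2) / d" "X$2 = (e$1 * q - f$1 * p) / d" by simp_all
    have "(p * f$2 - q * e$2) * e$1 + (e$1 * q - f$1 * p) * e$2 = p * d"
         "(p * f$2 - q * e$2) * f$1 + (e$1 * q - f$1 * p) * f$2 = q * d"
      by (simp_all add: d_def algebra_simps)
    then show "X$1 * e$1 + X$2 * e$2 = p \<and> X$1 * f$1 + X$2 * f$2 = q"
      using d by (simp add: X add_divide_distrib[symmetric] eq_divide_eq divide_eq_eq)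
  qed
  then show ?thesis unfolding iff by simp
qed

end

theory Submission
  imports Defs
begin

text \<open>
  The transport of \<open>X\<close> along \<open>PQ\<close> is the mirror image of \<open>P\<close> in the perpendicular
  bisector of \<open>X\<close> and \<open>Q\<close>: translating \<open>X\<close> by \<open>Q - P\<close> is the point reflection of \<open>P\<close> in
  the midpoint of \<open>XQ\<close>, and a point reflection followed by a reflection in a line through its
  centre is the reflection in the perpendicular line (\<open>cpx_transport\<close>).

  Let \<open>m\<^sub>1, m\<^sub>2, m\<^sub>3, m\<^sub>4\<close> be the reflections that interchange \<open>A' \<leftrightarrow> B\<close>, \<open>B' \<leftrightarrow> C\<close>,
  \<open>C' \<leftrightarrow> D\<close> and \<open>D' \<leftrightarrow> A\<close>. They carry \<open>A\<close> to \<open>B'\<close>, to \<open>C\<close>, to \<open>D'\<close> and back to \<open>A\<close>,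
  and they carry \<open>A'\<close> to \<open>B\<close>, to \<open>C'\<close>, to \<open>D\<close> and then to the end point of the transport.
  The composite of the four is a rotation about \<open>A\<close>, so \<open>A'B'C'D'\<close> closes up if
  and only if this rotation is the identity (\<open>closed_iff\<close>). The composite is the identity
  precisely when the four axes are concurrent or all parallel.

  Suppose the quadrilateral closes (\<open>closed_concurrent_or_parallel\<close>).
  A common point \<open>O\<close> of the axes satisfies \<open>OA = OB' = OC = OD'\<close>
  and \<open>OA' = OB = OC' = OD\<close>, so it lies on the perpendicular bisectors of both diagonals. Either
  it is the centre of \<open>C\<^sub>1\<close> and \<open>C\<^sub>2\<close>, and \<open>A'\<close> lies on \<open>C\<^sub>2\<close>, or these bisectors coincide and
  \<open>ABCD\<close> is a Darboux butterfly. If the axes are parallel, then \<open>AC\<close>, \<open>BD\<close> and \<open>A'B\<close> are all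
  perpendicular to them, so \<open>A'\<close> lies on the line \<open>BD = C\<^sub>2\<close>. Conversely, a start \<open>A'\<close> on
  \<open>C\<^sub>2\<close> forces all the axes through the centre, respectively perpendicular to the diagonals, and
  the quadrilateral closes (\<open>closed_if_concentric\<close>, \<open>closed_if_parallel\<close>).

  Hence, away from butterflies, the fixed points of the monodromy correspond to the
  intersection points of \<open>C\<^sub>2\<close> with the circle of radius \<open>l\<close> about \<open>A\<close>, and the
  trichotomy is the count of these points. For a butterfly with axis \<open>L\<close>, every \<open>A'\<close> is
  admissible: the perpendicular bisector of \<open>A'B\<close> either meets \<open>L\<close>, in a point that serves as
  centre, or is parallel to it, and then \<open>A'\<close> lies on \<open>BD\<close>.

  The plane is identified with the complex numbers, where a reflection
  is \<open>z \<mapsto> e * cnj z + f\<close> with \<open>cmod e = 1\<close>. The factor \<open>e\<close> encodes the direction of the axis,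
  so parallelism becomes equality of factors, and the rotation angle of a composite is read off
  from the product of the factors and their conjugates.
\<close>

section \<open>Reflections in perpendicular bisectors\<close>

text \<open>For \<open>X \<noteq> Q\<close>, \<open>mirror X Q\<close> is the reflection in the perpendicular bisector of \<open>X\<close> and \<open>Q\<close>,
  written as \<open>z \<mapsto> e * cnj z + f\<close> with \<open>e = mirror_factor X Q\<close>. The factor is the square of a
  unit vector along the axis.\<close>

definition mirror_factor :: "complex \<Rightarrow> complex \<Rightarrow> complex" where
  "mirror_factor X Q = - ((Q - X) / cnj (Q - X))"

definition mirror :: "complex \<Rightarrow> complex \<Rightarrow> complex \<Rightarrow> complex" where
  "mirror X Q z = Q + mirror_factor X Q * cnj (z - X)"

lemma mirror_factor_cnj_diff: "X \<noteq> Q \<Longrightarrow> mirror_factor X Q * cnj (Q - X) = - (Q - X)"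
  by (simp add: mirror_factor_def del: complex_cnj_diff)

lemma norm_mirror_factor: "X \<noteq> Q \<Longrightarrow> cmod (mirror_factor X Q) = 1"
  by (simp add: mirror_factor_def norm_divide del: complex_cnj_diff)

lemma mirror_factor_cnj:
  assumes "X \<noteq> Q" shows "mirror_factor X Q * cnj (mirror_factor X Q) = 1"
  using norm_mirror_factor[OF assms] by (simp flip: complex_norm_square)

lemma mirror_factor_unique:
  assumes "X \<noteq> Q" "e * cnj (Q - X) = - (Q - X)"
  shows "mirror_factor X Q = e"
proof -
  have "e = - (Q - X) / cnj (Q - X)"
    using assms by (subst nonzero_eq_divide_eq) auto
  then show ?thesis by (simp only: mirror_factor_def minus_divide_left)
qed

lemma mirror_factor_commute: "mirror_factor X Q = mirror_factor Q X"
  by (simp add: mirror_factor_def minus_divide_divide[symmetric, of "Q - X"])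

lemma mirror_left [simp]: "mirror X Q X = Q"
  by (simp add: mirror_def)

lemma mirror_right [simp]: "X \<noteq> Q \<Longrightarrow> mirror X Q Q = X"
  using mirror_factor_cnj_diff[of X Q] by (simp add: mirror_def)

lemma mirror_diff: "mirror X Q z - mirror X Q w = mirror_factor X Q * cnj (z - w)"
  by (simp add: mirror_def algebra_simps)

lemma dist_mirror: "X \<noteq> Q \<Longrightarrow> dist (mirror X Q z) (mirror X Q w) = dist z w"
  unfolding dist_norm mirror_diff by (simp add: norm_mult norm_mirror_factor del: complex_cnj_diff)

lemma mirror_mirror:
  assumes "X \<noteq> Q" shows "mirror X Q (mirror X Q z) = z"
proof -
  have "mirror X Q (mirror X Q z) - X = mirror X Q (mirror X Q z) - mirror X Q (mirror X Q X)"
    using assms by simp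
  also have "\<dots> = (mirror_factor X Q * cnj (mirror_factor X Q)) * (z - X)"
    unfolding mirror_diff by simp
  finally show ?thesis using mirror_factor_cnj[OF assms] by simp
qed

lemma mirror_fixed_iff:
  assumes "X \<noteq> Q" shows "mirror X Q z = z \<longleftrightarrow> dist z X = dist z Q"
proof -
  let ?w = "Q - X"
  have "mirror X Q z = z \<longleftrightarrow> (z - Q) * cnj ?w = - ?w * cnj (z - X)"
    using assms by (auto simp: mirror_def mirror_factor_def field_simps)
  also have "\<dots> \<longleftrightarrow> (z - X) * cnj (z - X) = (z - Q) * cnj (z - Q)"
    by (simp add: algebra_simps)
  also have "\<dots> \<longleftrightarrow> (cmod (z - X))\<^sup>2 = (cmod (z - Q))\<^sup>2"
    by (metis complex_norm_square of_real_eq_iff)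
  finally show ?thesis by (simp add: dist_norm)
qed

lemma mirror_factor_eq_iff:
  assumes "X \<noteq> Q" "Y \<noteq> R"
  shows "mirror_factor X Q = mirror_factor Y R \<longleftrightarrow> Im ((Q - X) * cnj (R - Y)) = 0"
proof -
  have "mirror_factor X Q = mirror_factor Y R \<longleftrightarrow> (Q - X) * cnj (R - Y) = cnj ((Q - X) * cnj (R - Y))"
    using assms by (simp add: mirror_factor_def frac_eq_eq mult.commute del: complex_cnj_diff)
  also have "\<dots> \<longleftrightarrow> Im ((Q - X) * cnj (R - Y)) = 0"
    by (metis Reals_cnj_iff complex_is_Real_iff)
  finally show ?thesis .
qed

text \<open>A reflection moves every point perpendicularly to its axis, so it is also the
  reflection interchanging any other point with its image, and has the same factor.\<close>

lemma mirror_factor_displacement: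
  assumes "X \<noteq> Q" "z \<noteq> mirror X Q z" shows "mirror_factor z (mirror X Q z) = mirror_factor X Q"
  using assms mirror_diff[of X Q "mirror X Q z" z]
  by (intro mirror_factor_unique) (simp_all add: mirror_mirror)

text \<open>If \<open>m\<^sub>2 (m\<^sub>1 z) = z\<close>, then both reflections move \<open>z\<close> to the same point. Were this point
  different from \<open>z\<close>, both axes would be the perpendicular bisector of the two.\<close>

lemma mirror_fixed_of_composite:
  assumes "X \<noteq> Q" "Y \<noteq> R" "mirror_factor X Q \<noteq> mirror_factor Y R"
    and "mirror Y R (mirror X Q z) = z"
  shows "mirror X Q z = z" "mirror Y R z = z"
proof -
  have *: "mirror X Q z = mirror Y R z" using assms mirror_mirror by metis
  then show "mirror X Q z = z"
    using assms mirror_factor_displacement by metis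
  with * show "mirror Y R z = z" by simp
qed

lemma mirror_composite_diff:
  "mirror Y R (mirror X Q z) - mirror Y R (mirror X Q w)
    = mirror_factor Y R * cnj (mirror_factor X Q) * (z - w)"
  by (simp add: mirror_diff)

lemma mirror_factor_cnj_eq_1_iff:
  assumes "X \<noteq> Q"
  shows "e * cnj (mirror_factor X Q) = 1 \<longleftrightarrow> e = mirror_factor X Q"
  using mirror_factor_cnj[OF assms]
  by (metis mult.commute mult.left_commute mult.right_neutral)

text \<open>The composite of the two reflections is the rotation \<open>z \<mapsto> p * z + q\<close> with \<open>p \<noteq> 1\<close>; its
  centre \<open>q / (1 - p)\<close> is the common point of the axes.\<close>

lemma mirrors_meet:
  assumes "X \<noteq> Q" "Y \<noteq> R" "mirror_factor X Q \<noteq> mirror_factor Y R"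
  obtains z where "mirror X Q z = z" "mirror Y R z = z"
proof -
  let ?p = "mirror_factor Y R * cnj (mirror_factor X Q)"
  define q where "q = mirror Y R (mirror X Q 0)"
  have p: "1 - ?p \<noteq> 0" using mirror_factor_cnj_eq_1_iff[of X Q "mirror_factor Y R"] assms by auto
  have "mirror Y R (mirror X Q (q / (1 - ?p))) = ?p * (q / (1 - ?p)) + q"
    using mirror_composite_diff[of Y R X Q "q / (1 - ?p)" 0] by (simp add: q_def algebra_simps)
  also have "\<dots> = q / (1 - ?p)" using p by (simp add: field_simps)
  finally show thesis using mirror_fixed_of_composite[OF assms] that by blast
qed

text \<open>Reflections in parallel axes compose to a translation perpendicular to the axes.\<close>

lemma mirror_factor_composite:
  assumes "X \<noteq> Q" "Y \<noteq> R" "mirror_factor X Q = mirror_factor Y R"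
    and "z \<noteq> mirror Y R (mirror X Q z)"
  shows "mirror_factor z (mirror Y R (mirror X Q z)) = mirror_factor X Q"
proof (rule mirror_factor_unique)
  let ?u = "mirror X Q z" and ?e = "mirror_factor X Q"
  have "?e * cnj (mirror Y R ?u - ?u) = - (mirror Y R ?u - ?u)"
    using mirror_diff[of Y R "mirror Y R ?u" ?u] assms by (simp add: mirror_mirror)
  moreover have "?e * cnj (z - ?u) = - (z - ?u)"
    using mirror_diff[of X Q z ?u] assms by (simp add: mirror_mirror)
  ultimately show "?e * cnj (mirror Y R ?u - z) = - (mirror Y R ?u - z)"
    by (simp add: algebra_simps)
qed (use assms in auto)


text \<open>One round of transports in complex coordinates; \<open>end_point\<close> below is the transport of
  \<open>D'\<close> along \<open>DA\<close>.\<close>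

locale bicycle_chain =
  fixes A B C D A' B' C' D' :: complex and l :: real
  assumes l: "l > 0" "dist A A' = l"
    and sides: "l \<noteq> dist A B" "l \<noteq> dist B C" "l \<noteq> dist C D" "l \<noteq> dist D A"
    and vertices: "A \<noteq> B" "A \<noteq> C" "A \<noteq> D" "B \<noteq> C" "B \<noteq> D" "C \<noteq> D"
    and steps: "B' = mirror A' B A" "C' = mirror B' C B" "D' = mirror C' D C"
begin

abbreviation "end_point \<equiv> mirror D' A D"
abbreviation "e1 \<equiv> mirror_factor A' B"
abbreviation "e2 \<equiv> mirror_factor B' C"
abbreviation "e3 \<equiv> mirror_factor C' D"
abbreviation "e4 \<equiv> mirror_factor D' A"

lemma A'_noteq_B: "A' \<noteq> B" using l sides by auto

lemma dist_B_B': "dist B B' = l"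
  using dist_mirror[OF A'_noteq_B, of A' A] l by (simp add: steps dist_commute)

lemma B'_noteq_C: "B' \<noteq> C" using dist_B_B' sides by auto

lemma dist_C_C': "dist C C' = l"
  using dist_mirror[OF B'_noteq_C, of B' B] dist_B_B' by (simp add: steps(2) dist_commute)

lemma C'_noteq_D: "C' \<noteq> D" using dist_C_C' sides by auto

lemma dist_D_D': "dist D D' = l"
  using dist_mirror[OF C'_noteq_D, of C' C] dist_C_C' by (simp add: steps(3) dist_commute)

lemma D'_noteq_A: "D' \<noteq> A" using dist_D_D' sides by auto

lemmas noteqs = A'_noteq_B B'_noteq_C C'_noteq_D D'_noteq_A

lemma images:
  "mirror A' B A' = B" "mirror A' B A = B'" "mirror B' C B' = C" "mirror B' C B = C'"
  "mirror C' D C' = D" "mirror C' D C = D'" "mirror D' A D' = A"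
  by (simp_all only: mirror_left steps[symmetric])

text \<open>The composite of the four reflections is orientation preserving and fixes \<open>A\<close>.\<close>

lemma round_trip:
  "mirror D' A (mirror C' D (mirror B' C (mirror A' B z))) - A
     = (e4 * cnj e3) * (e2 * cnj e1) * (z - A)"
proof -
  have "mirror D' A (mirror C' D (mirror B' C (mirror A' B A))) = A"
    by (simp only: images)
  then show ?thesis
    using mirror_composite_diff[of D' A C' D "mirror B' C (mirror A' B z)" "mirror B' C (mirror A' B A)"]
    by (simp only: mirror_composite_diff mult.assoc)
qed

lemma closed_iff: "end_point = A' \<longleftrightarrow> (e4 * cnj e3) * (e2 * cnj e1) = 1"
proof -
  have "end_point - A = (e4 * cnj e3) * (e2 * cnj e1) * (A' - A)"
    using round_trip[of A'] by (simp only: images)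
  moreover have "A' - A \<noteq> 0" using l by auto
  ultimately show ?thesis by (metis diff_eq_eq mult_cancel_right1 diff_add_cancel)
qed

text \<open>Closure says that \<open>m\<^sub>2 \<circ> m\<^sub>1\<close> is inverse to \<open>m\<^sub>4 \<circ> m\<^sub>3\<close>. If this is a rotation, all four
  axes pass through its centre. Otherwise it is a translation, nontrivial because it takes \<open>A\<close> to
  \<open>C\<close>; then all axes are perpendicular to \<open>AC\<close>, and the translation \<open>m\<^sub>3 \<circ> m\<^sub>2\<close> taking \<open>B\<close> to
  \<open>D\<close> is parallel to \<open>AC\<close> too.\<close>

lemma closed_concurrent_or_parallel:
  assumes "end_point = A'"
  shows "(\<exists>z. dist z A = dist z C \<and> dist z B = dist z D \<and> dist z A' = dist z B) \<or>
    (mirror_factor A' B = mirror_factor A C \<and> mirror_factor B D = mirror_factor A C)"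
proof (cases "e1 = e2")
  case True
  then have "e4 = e3"
    using assms closed_iff noteqs by (simp add: mirror_factor_cnj mirror_factor_cnj_eq_1_iff)
  have "e1 = mirror_factor A C"
    using mirror_factor_composite[OF noteqs(1,2) True, of A] vertices by (simp add: images)
  moreover have "e3 = mirror_factor A C"
    using mirror_factor_composite[OF noteqs(3,4) \<open>e4 = e3\<close>[symmetric], of C] vertices
    by (simp add: images mirror_factor_commute)
  moreover have "mirror_factor B D = e2"
    using mirror_factor_composite[OF noteqs(2,3), of B] vertices True calculation by (simp add: images)
  ultimately show ?thesis using True by simp
next
  case False
  then obtain z where z: "mirror A' B z = z" "mirror B' C z = z"
    using mirrors_meet noteqs by metis
  have "e3 \<noteq> e4"
    using assms closed_iff False noteqs mirror_factor_cnj_eq_1_iff[of A' B e2]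
    by (auto simp: mirror_factor_cnj)
  moreover have "mirror D' A (mirror C' D z) = z"
    using round_trip[of z] assms closed_iff z by simp
  ultimately have z': "mirror C' D z = z" "mirror D' A z = z"
    using mirror_fixed_of_composite noteqs by blast+
  have "dist z A = dist z C"
    using dist_mirror[OF noteqs(1), of z A] z mirror_fixed_iff[OF noteqs(2)] by (simp add: images)
  moreover have "dist z B = dist z D"
    using dist_mirror[OF noteqs(2), of z B] z z' mirror_fixed_iff[OF noteqs(3)] by (simp add: images)
  moreover have "dist z A' = dist z B"
    using z mirror_fixed_iff[OF noteqs(1)] by simp
  ultimately show ?thesis by blast
qed

text \<open>Each axis in turn passes through \<open>z\<close>, since the two points it interchanges are equidistant
  from \<open>z\<close>. The round trip is then a rotation with the two fixed points \<open>A\<close> and \<open>z\<close>, hence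
  the identity.\<close>

lemma closed_if_concentric:
  assumes z: "dist z A = dist z C" "dist z B = dist z D" "dist z A' = dist z B"
  shows "end_point = A'" "dist z B' = dist z A" "dist z C' = dist z B" "dist z D' = dist z A"
proof -
  have m1: "mirror A' B z = z" using z by (simp add: mirror_fixed_iff noteqs)
  show B': "dist z B' = dist z A"
    using dist_mirror[OF noteqs(1), of z A] by (simp add: m1 images)
  then have m2: "mirror B' C z = z" using z by (simp add: mirror_fixed_iff noteqs)
  show C': "dist z C' = dist z B"
    using dist_mirror[OF noteqs(2), of z B] by (simp add: m2 images)
  then have m3: "mirror C' D z = z" using z by (simp add: mirror_fixed_iff noteqs)
  show D': "dist z D' = dist z A"
    using dist_mirror[OF noteqs(3), of z C] z by (simp add: m3 images)
  then have m4: "mirror D' A z = z" by (simp add: mirror_fixed_iff noteqs)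
  have "z \<noteq> A" using z vertices by auto
  moreover have "(e4 * cnj e3) * (e2 * cnj e1) * (z - A) = z - A"
    using round_trip[of z] by (simp add: m1 m2 m3 m4)
  ultimately show "end_point = A'"
    by (simp add: closed_iff)
qed

text \<open>Displacements by reflections with axes perpendicular to the common direction of the diagonals
  keep points on the lines \<open>AC\<close> and \<open>BD\<close>, which forces the next axis to have the same direction.
  With four equal factors the round trip is a translation fixing \<open>A\<close>.\<close>

lemma closed_if_parallel:
  assumes "mirror_factor A' B = mirror_factor A C" "mirror_factor B D = mirror_factor A C"
  shows "end_point = A'"
    "Im ((B' - A) * cnj (C - A)) = 0" "Im ((C' - B) * cnj (D - B)) = 0"
    "Im ((D' - A) * cnj (C - A)) = 0"
proof -
  have par: "Im ((mirror X Q z - z) * cnj (R - Y)) = 0"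
    if "mirror_factor X Q = mirror_factor Y R" "X \<noteq> Q" "Y \<noteq> R" for X Q Y R z
    using that mirror_factor_displacement[of X Q z] mirror_factor_eq_iff[of z "mirror X Q z" Y R]
    by (cases "z = mirror X Q z") auto
  have fac: "mirror_factor X Q = mirror_factor Y R"
    if "Im ((X - Y) * cnj (R - Y)) = 0" "X \<noteq> Q" "Y \<noteq> R" "Q = Y \<or> Q = R" for X Q Y R
  proof -
    have "Im ((Q - X) * cnj (R - Y)) = 0"
      using that(1,4) by (auto simp: algebra_simps)
    then show ?thesis using that by (simp add: mirror_factor_eq_iff)
  qed
  show B': "Im ((B' - A) * cnj (C - A)) = 0"
    using par[OF assms(1), of A] noteqs vertices by (simp add: images)
  then have e2: "e2 = mirror_factor A C" using fac noteqs vertices by blast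
  then show C': "Im ((C' - B) * cnj (D - B)) = 0"
    using par[of B' C B D B] noteqs vertices assms by (simp add: images)
  then have e3: "e3 = mirror_factor A C" using fac noteqs vertices assms by metis
  have "Im ((D' - C) * cnj (C - A)) = 0"
    using par[OF e3, of C] noteqs vertices by (simp add: images)
  then show D': "Im ((D' - A) * cnj (C - A)) = 0"
    by (simp add: algebra_simps)
  then have e4: "e4 = mirror_factor A C" using fac noteqs vertices by metis
  show "end_point = A'"
    using vertices by (simp add: closed_iff assms(1) e2 e3 e4 mirror_factor_cnj)
qed

text \<open>Adjacent vertices are distinct because transport preserves side lengths. If \<open>A' = C'\<close>, then
  \<open>m\<^sub>2 \<circ> m\<^sub>1\<close> fixes \<open>A'\<close> while taking \<open>A\<close> to \<open>C \<noteq> A\<close>, so it is a rotation about \<open>A'\<close> and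
  \<open>m\<^sub>1\<close> fixes \<open>A'\<close>, which contradicts \<open>m\<^sub>1 A' = B\<close>. The other diagonal is similar.\<close>

lemma closed_imp_distinct:
  assumes "end_point = A'"
  shows "distinct [A', B', C', D']"
proof -
  have lengths: "dist A' B' = dist A B" "dist B' C' = dist B C" "dist C' D' = dist C D"
    "dist A' D' = dist A D"
    using dist_mirror[OF noteqs(1), of B A] dist_mirror[OF noteqs(2), of C B]
       dist_mirror[OF noteqs(3), of D C] dist_mirror[OF noteqs(4), of A D] noteqs assms
    by (auto simp: images dist_commute)
  have "A' \<noteq> C'"
  proof
    assume "A' = C'"
    then have *: "mirror B' C (mirror A' B A') = A'" by (simp add: images)
    then have "e1 = e2"
      using mirror_fixed_of_composite(1)[OF noteqs(1,2) _ *] noteqs by auto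
    moreover have "C' - C = e2 * cnj e1 * (A' - A)"
      using mirror_composite_diff[of B' C A' B A' A] by (simp only: images)
    ultimately show False
      using \<open>A' = C'\<close> vertices mirror_factor_cnj[OF noteqs(2)] by simp
  qed
  moreover have "B' \<noteq> D'"
  proof
    assume "B' = D'"
    then have *: "mirror C' D (mirror B' C B') = B'" by (simp add: images)
    then have "e2 = e3"
      using mirror_fixed_of_composite(1)[OF noteqs(2,3) _ *] noteqs by auto
    moreover have "D' - D = e3 * cnj e2 * (B' - B)"
      using mirror_composite_diff[of C' D B' C B' B] by (simp only: images)
    ultimately show False
      using \<open>B' = D'\<close> vertices mirror_factor_cnj[OF noteqs(3)] by simp
  qed
  moreover have "A' \<noteq> B'" "B' \<noteq> C'" "C' \<noteq> D'" "A' \<noteq> D'"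
    using vertices lengths by auto
  ultimately show ?thesis by simp
qed

end


section \<open>The Euclidean plane in complex coordinates\<close>

definition cpx :: "real^2 \<Rightarrow> complex" where
  "cpx x = Complex (x $ 1) (x $ 2)"

lemma cpx_diff: "cpx (x - y) = cpx x - cpx y"
  and cpx_add: "cpx (x + y) = cpx x + cpx y"
  and cpx_scaleR: "cpx (c *\<^sub>R x) = of_real c * cpx x"
  by (simp_all add: cpx_def complex_eq_iff)

lemmas cpx_linear = cpx_diff cpx_add cpx_scaleR

lemma norm_cpx: "cmod (cpx x) = norm x"
  by (simp add: cpx_def cmod_def norm_eq_sqrt_inner inner_vec_def sum_2 power2_eq_square)

lemma dist_cpx [simp]: "dist (cpx x) (cpx y) = dist x y"
  by (simp add: dist_norm norm_cpx flip: cpx_diff)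

lemma cmod_cpx_diff: "cmod (cpx x - cpx y) = dist x y"
  by (simp flip: dist_norm)

lemma cpx_eq_iff [simp]: "cpx x = cpx y \<longleftrightarrow> x = y"
  by (metis dist_cpx dist_eq_0_iff)

lemma surj_cpx: "\<exists>x. cpx x = z"
  by (rule exI[of _ "vector [Re z, Im z]"]) (simp add: cpx_def)

lemma inner_eq_Re: "x \<bullet> y = Re (cpx x * cnj (cpx y))"
  by (simp add: cpx_def inner_vec_def sum_2)

lemma Im_cnj_eq_0_iff:
  assumes "w \<noteq> 0" shows "Im (z * cnj w) = 0 \<longleftrightarrow> (\<exists>t. z = of_real t * w)"
proof
  assume "Im (z * cnj w) = 0"
  then have "z * cnj w = of_real (Re (z * cnj w))" by (simp add: complex_eq_iff)
  moreover have "z = (z * cnj w) / (w * cnj w) * w" using assms by simp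
  ultimately have "z = of_real (Re (z * cnj w) / (cmod w)\<^sup>2) * w"
    by (metis complex_norm_square of_real_divide)
  then show "\<exists>t. z = of_real t * w" by blast
qed auto

lemma cpx_reflection_line:
  assumes "P \<noteq> Q"
  shows "cpx (reflection (line P Q) X)
    = cpx P + (cpx Q - cpx P) / cnj (cpx Q - cpx P) * cnj (cpx X - cpx P)"
proof -
  define v w where "v = cpx X - cpx P" and "w = cpx Q - cpx P"
  have "w \<noteq> 0" using assms by (simp add: w_def)
  have "of_real (2 * Re (v * cnj w)) = v * cnj w + cnj v * w"
    by (simp add: complex_eq_iff)
  then have "of_real (2 * Re (v * cnj w) / (cmod w)\<^sup>2) * w - v = w / cnj w * cnj v"
    using \<open>w \<noteq> 0\<close> by (simp add: complex_norm_square[unfolded of_real_power] field_simps)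
  moreover have "cpx (reflection (line P Q) X)
      = cpx P + of_real (2 * Re (v * cnj w) / (cmod w)\<^sup>2) * w - v"
    unfolding reflection_line[OF assms] inner_eq_Re norm_cpx[symmetric] cpx_linear v_def w_def ..
  ultimately show ?thesis by (simp add: v_def w_def diff_eq_eq)
qed

text \<open>The reflection of \<open>X + Q - P\<close> in the line \<open>XQ\<close> is the reflection of \<open>P\<close> in the perpendicular
  bisector of \<open>X\<close> and \<open>Q\<close>.\<close>

lemma cpx_transport:
  assumes "X \<noteq> Q"
  shows "cpx (transport P Q X) = mirror (cpx X) (cpx Q) (cpx P)"
proof -
  define w where "w = cpx Q - cpx X"
  have w: "w \<noteq> 0" using assms by (simp add: w_def)
  have "cpx (transport P Q X) = cpx X + w / cnj w * cnj (cpx Q - cpx P)"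
    using assms by (simp add: transport_def cpx_reflection_line cpx_linear w_def)
  also have "cpx Q - cpx P = w - (cpx P - cpx X)" by (simp add: w_def)
  also have "cpx X + w / cnj w * cnj (w - (cpx P - cpx X)) = cpx Q + - (w / cnj w) * cnj (cpx P - cpx X)"
    using w by (simp add: w_def field_simps)
  finally show ?thesis by (simp only: mirror_def mirror_factor_def w_def)
qed

lemma mem_line_iff:
  assumes "P \<noteq> Q"
  shows "X \<in> line P Q \<longleftrightarrow> Im ((cpx X - cpx P) * cnj (cpx Q - cpx P)) = 0"
proof -
  have "X \<in> line P Q \<longleftrightarrow> (\<exists>t. cpx X = cpx (P + t *\<^sub>R (Q - P)))"
    by (auto simp: line_altdef)
  also have "\<dots> \<longleftrightarrow> (\<exists>t. cpx X - cpx P = of_real t * (cpx Q - cpx P))"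
    by (auto simp: cpx_linear algebra_simps)
  also have "\<dots> \<longleftrightarrow> Im ((cpx X - cpx P) * cnj (cpx Q - cpx P)) = 0"
    using assms by (intro Im_cnj_eq_0_iff[symmetric]) simp
  finally show ?thesis .
qed

lemma mem_line_iff_mirror_factor:
  assumes "P \<noteq> Q" "X \<noteq> P"
  shows "X \<in> line P Q \<longleftrightarrow> mirror_factor (cpx P) (cpx X) = mirror_factor (cpx P) (cpx Q)"
  unfolding mem_line_iff[OF assms(1)] using assms by (intro mirror_factor_eq_iff[symmetric]) auto

lemma parallel_diagonals_iff:
  assumes "A \<noteq> C" "B \<noteq> D"
  shows "parallel_diagonals A B C D \<longleftrightarrow> Im ((cpx D - cpx B) * cnj (cpx C - cpx A)) = 0"
proof -
  have "parallel_diagonals A B C D \<longleftrightarrow> (\<exists>k. D - B = k *\<^sub>R (C - A))"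
  proof
    assume "parallel_diagonals A B C D"
    then obtain a where a: "line B D = (\<lambda>x. a + x) ` line A C"
      by (auto simp: parallel_diagonals_def affine_parallel_def)
    have "B \<in> line B D" "D \<in> line B D" by (auto simp: line_def hull_inc)
    then have "B \<in> (\<lambda>x. a + x) ` line A C" "D \<in> (\<lambda>x. a + x) ` line A C"
      unfolding a by simp_all
    then obtain s t where "B = a + (A + s *\<^sub>R (C - A))" "D = a + (A + t *\<^sub>R (C - A))"
      unfolding line_altdef by blast
    then have "D - B = (t - s) *\<^sub>R (C - A)" by (simp add: scaleR_diff_left)
    then show "\<exists>k. D - B = k *\<^sub>R (C - A)" by blast
  next
    assume "\<exists>k. D - B = k *\<^sub>R (C - A)"
    then obtain k where k: "D - B = k *\<^sub>R (C - A)" by blast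
    then have "k \<noteq> 0" using assms by auto
    have "line B D = (\<lambda>x. (B - A) + x) ` line A C"
    proof (intro equalityI subsetI)
      fix x assume "x \<in> line B D"
      then obtain t where "x = B + t *\<^sub>R (D - B)" unfolding line_altdef by blast
      then have "x = (B - A) + (A + (t * k) *\<^sub>R (C - A))" by (simp add: k)
      then show "x \<in> (\<lambda>x. (B - A) + x) ` line A C" unfolding line_altdef by blast
    next
      fix x assume "x \<in> (\<lambda>x. (B - A) + x) ` line A C"
      then obtain t where "x = (B - A) + (A + t *\<^sub>R (C - A))"
        unfolding line_altdef by blast
      then have "x = B + (t / k) *\<^sub>R (D - B)"
        using \<open>k \<noteq> 0\<close> by (simp add: k)
      then show "x \<in> line B D" unfolding line_altdef by blast
    qed
    then show "parallel_diagonals A B C D"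
      unfolding parallel_diagonals_def affine_parallel_def by blast
  qed
  also have "\<dots> \<longleftrightarrow> (\<exists>k. cpx (D - B) = cpx (k *\<^sub>R (C - A)))" by (simp only: cpx_eq_iff)
  also have "\<dots> \<longleftrightarrow> Im ((cpx D - cpx B) * cnj (cpx C - cpx A)) = 0"
    unfolding cpx_linear using assms by (intro Im_cnj_eq_0_iff[symmetric]) simp
  finally show ?thesis .
qed

lemma mem_perp_bisector_iff: "X \<in> perp_bisector P Q \<longleftrightarrow> dist X P = dist X Q"
proof -
  have "dist X P = dist X Q \<longleftrightarrow> (X - P) \<bullet> (X - P) = (X - Q) \<bullet> (X - Q)"
    by (simp add: dist_norm norm_eq_sqrt_inner)
  also have "\<dots> \<longleftrightarrow> (X - midpoint P Q) \<bullet> (Q - P) = 0"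
    by (auto simp: midpoint_def algebra_simps inner_commute)
  finally show ?thesis by (simp add: perp_bisector_def)
qed

lemma center_eqI:
  assumes "quadrilateral A B C D" "\<not> parallel_diagonals A B C D"
    and "dist X A = dist X C" "dist X B = dist X D"
  shows "center A B C D = X"
  unfolding center_def using ex1_center[OF assms(1,2)] assms(3,4)
  by (intro the1_equality) (simp_all add: mem_perp_bisector_iff)

lemma center_equidistant:
  assumes "quadrilateral A B C D" "\<not> parallel_diagonals A B C D"
  shows "dist (center A B C D) A = dist (center A B C D) C"
    "dist (center A B C D) B = dist (center A B C D) D"
  using theI'[OF ex1_center[OF assms]] by (simp_all add: mem_perp_bisector_iff center_def)

lemma is_line_imp_line:
  assumes "is_line L" obtains P Q where "P \<noteq> Q" "L = line P Q"
proof -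
  obtain b where b: "\<not> affine_dependent b" "affine hull b = L" "int (card b) = 2"
    using assms aff_dim_basis_exists[of L] affine_hull_eq[of L] by (auto simp: is_line_def)
  then have "card b = 2" by simp
  then obtain P Q where "b = {P, Q}" "P \<noteq> Q" by (auto simp: card_2_iff)
  with b that show thesis unfolding line_def by blast
qed

lemma is_line_line: "P \<noteq> Q \<Longrightarrow> is_line (line P Q)"
  by (simp add: is_line_def line_def aff_dim_affine_hull aff_dim_2)

lemma reflection_eq_mirror:
  assumes "P \<noteq> Q" "mirror X Y (cpx P) = cpx P"
    "mirror_factor X Y = (cpx Q - cpx P) / cnj (cpx Q - cpx P)"
  shows "cpx (reflection (line P Q) Z) = mirror X Y (cpx Z)"
  using mirror_diff[of X Y "cpx Z" "cpx P"] assms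
  by (simp add: cpx_reflection_line diff_eq_eq add.commute del: complex_cnj_diff)

text \<open>A line that interchanges \<open>A\<close> and \<open>C\<close> is their perpendicular bisector.\<close>

lemma darboux_butterfly_iff:
  assumes "A \<noteq> C"
  shows "darboux_butterfly A B C D \<longleftrightarrow> mirror (cpx A) (cpx C) (cpx B) = cpx D"
proof
  assume "darboux_butterfly A B C D"
  then obtain P Q where PQ: "P \<noteq> Q" "reflection (line P Q) A = C" "reflection (line P Q) C = A"
      "reflection (line P Q) B = D"
    unfolding darboux_butterfly_def by (metis is_line_imp_line)
  define e where "e = (cpx Q - cpx P) / cnj (cpx Q - cpx P)"
  have *: "cpx C = cpx P + e * cnj (cpx A - cpx P)" "cpx A = cpx P + e * cnj (cpx C - cpx P)"
    "cpx D = cpx P + e * cnj (cpx B - cpx P)"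
    using cpx_reflection_line[OF PQ(1)] PQ(2-) unfolding e_def by metis+
  have "e * cnj (cpx C - cpx A) = - (cpx C - cpx A)"
  proof -
    have "cpx C - cpx A = e * cnj (cpx A - cpx P) - e * cnj (cpx C - cpx P)"
      using *(1,2) by (metis add_diff_cancel_left)
    then show ?thesis by (simp add: algebra_simps)
  qed
  then have "mirror_factor (cpx A) (cpx C) = e"
    using assms by (intro mirror_factor_unique) auto
  then show "mirror (cpx A) (cpx C) (cpx B) = cpx D"
  proof -
    have "cpx D - cpx C = e * cnj (cpx B - cpx P) - e * cnj (cpx A - cpx P)"
      using *(1,3) by (metis add_diff_cancel_left)
    also have "\<dots> = e * cnj (cpx B - cpx A)" by (simp add: algebra_simps)
    also have "\<dots> = mirror (cpx A) (cpx C) (cpx B) - cpx C"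
      using mirror_diff[of "cpx A" "cpx C" "cpx B" "cpx A"] \<open>mirror_factor (cpx A) (cpx C) = e\<close> by simp
    finally show ?thesis by simp
  qed
next
  assume D: "mirror (cpx A) (cpx C) (cpx B) = cpx D"
  obtain d where d: "cpx d = \<i> * (cpx C - cpx A)" using surj_cpx by blast
  define P where "P = midpoint A C"
  have neq: "P \<noteq> P + d"
  proof
    assume "P = P + d"
    then have "cpx d = cpx 0" by simp
    then show False using assms d by (simp add: cpx_def[of 0] zero_complex.code[symmetric])
  qed
  have "mirror (cpx A) (cpx C) (cpx P) = cpx P"
    using assms by (simp add: mirror_fixed_iff P_def dist_midpoint)
  moreover have "mirror_factor (cpx A) (cpx C) = (cpx (P + d) - cpx P) / cnj (cpx (P + d) - cpx P)"
    by (simp add: mirror_factor_def cpx_add d)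
  ultimately have *: "cpx (reflection (line P (P + d)) Z) = mirror (cpx A) (cpx C) (cpx Z)" for Z
    using reflection_eq_mirror[OF neq] by blast
  have "reflection (line P (P + d)) A = C" "reflection (line P (P + d)) C = A"
    "reflection (line P (P + d)) B = D" "reflection (line P (P + d)) D = B"
    using assms by (simp_all add: * D flip: cpx_eq_iff) (simp add: D[symmetric] mirror_mirror)
  then show "darboux_butterfly A B C D"
    unfolding darboux_butterfly_def using is_line_line[OF neq] by blast
qed

text \<open>Counting intersections of the circle of radius \<open>\<rho>\<close> about the origin with a vertical line. The
  similarity \<open>X \<mapsto> (cpx X - a) / b\<close> is built in because intersecting two circles and intersecting a
  circle with an arbitrary line both reduce to this normal form.\<close>

lemma chord_points:
  fixes a b :: complex and \<kappa> \<rho> :: real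
  assumes "b \<noteq> 0" "\<rho> > 0"
  defines "S \<equiv> {X. Re ((cpx X - a) / b) = \<kappa> \<and> cmod ((cpx X - a) / b) = \<rho>}"
  shows "\<rho> < \<bar>\<kappa>\<bar> \<Longrightarrow> S = {}" "\<rho> = \<bar>\<kappa>\<bar> \<Longrightarrow> card S = 1" "\<bar>\<kappa>\<bar> < \<rho> \<Longrightarrow> card S = 2"
proof -
  let ?f = "\<lambda>X. (cpx X - a) / b"
  define T where "T = {y. Re y = \<kappa> \<and> cmod y = \<rho>}"
  have inj: "inj_on ?f S" using assms(1) by (auto simp: inj_on_def)
  have "\<exists>X. ?f X = y" for y
    using surj_cpx[of "a + b * y"] assms(1) by (metis add_diff_cancel_left' nonzero_mult_div_cancel_left)
  then have "T \<subseteq> range ?f" by (metis rangeI subsetI)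
  then have "?f ` S = T" unfolding S_def T_def by auto
  then have card: "card S = card T" and empty: "S = {} \<longleftrightarrow> T = {}"
    using card_image[OF inj] by auto
  have T: "T = {Complex \<kappa> t | t. t\<^sup>2 = \<rho>\<^sup>2 - \<kappa>\<^sup>2}"
  proof -
    have "cmod (Complex \<kappa> t) = \<rho> \<longleftrightarrow> t\<^sup>2 = \<rho>\<^sup>2 - \<kappa>\<^sup>2" for t
      using assms(2) power2_eq_iff_nonneg[of "cmod (Complex \<kappa> t)" \<rho>]
      by (auto simp: cmod_power2)
    then have "y \<in> T \<longleftrightarrow> Re y = \<kappa> \<and> (Im y)\<^sup>2 = \<rho>\<^sup>2 - \<kappa>\<^sup>2" for y
      unfolding T_def by (cases y) auto
    then show ?thesis by (auto simp: complex_eq_iff)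
  qed
  show "S = {}" if "\<rho> < \<bar>\<kappa>\<bar>"
    unfolding empty T_def using that abs_Re_le_cmod leD by blast
  show "card S = 1" if "\<rho> = \<bar>\<kappa>\<bar>"
  proof -
    have "T = {Complex \<kappa> 0}" unfolding T using that by auto
    then show ?thesis by (simp add: card)
  qed
  show "card S = 2" if "\<bar>\<kappa>\<bar> < \<rho>"
  proof -
    define s where "s = sqrt (\<rho>\<^sup>2 - \<kappa>\<^sup>2)"
    have "\<kappa>\<^sup>2 < \<rho>\<^sup>2" using that power_strict_mono[of "\<bar>\<kappa>\<bar>" \<rho> 2] by simp
    then have s: "s > 0" "s\<^sup>2 = \<rho>\<^sup>2 - \<kappa>\<^sup>2" by (simp_all add: s_def)
    then have "T = {Complex \<kappa> s, Complex \<kappa> (- s)}"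
      unfolding T s(2)[symmetric] power2_eq_iff by auto
    then show ?thesis using s(1) by (simp add: card)
  qed
qed

text \<open>Normalising by \<open>Z \<mapsto> 0\<close> and \<open>A \<mapsto> 1\<close>, the radical axis of the two circles becomes the vertical
  line with abscissa \<open>(r\<^sup>2 + s\<^sup>2 - l\<^sup>2) / (2 * r\<^sup>2)\<close>.\<close>

lemma circle_intersection_count:
  fixes Z A :: "real^2"
  assumes "dist Z A = r" "r > 0" "s > 0" "l > 0"
  defines "S \<equiv> {X. dist Z X = s \<and> dist A X = l}"
  shows "2 * r * s < \<bar>r\<^sup>2 + s\<^sup>2 - l\<^sup>2\<bar> \<Longrightarrow> S = {}"
    "2 * r * s = \<bar>r\<^sup>2 + s\<^sup>2 - l\<^sup>2\<bar> \<Longrightarrow> card S = 1"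
    "\<bar>r\<^sup>2 + s\<^sup>2 - l\<^sup>2\<bar> < 2 * r * s \<Longrightarrow> card S = 2"
proof -
  let ?k = "r\<^sup>2 + s\<^sup>2 - l\<^sup>2"
  define b where "b = cpx A - cpx Z"
  have r: "cmod b = r" using assms(1) by (metis b_def dist_cpx dist_norm dist_commute)
  then have b: "b \<noteq> 0" using assms by auto
  have "dist Z X = s \<and> dist A X = l \<longleftrightarrow>
    Re ((cpx X - cpx Z) / b) = ?k / (2 * r\<^sup>2) \<and> cmod ((cpx X - cpx Z) / b) = s / r" for X
  proof -
    define x where "x = cpx X - cpx Z"
    have X: "dist Z X = cmod x" "dist A X = cmod (x - b)"
      by (simp_all add: x_def b_def cmod_cpx_diff dist_commute)
    have "(cmod (x - b))\<^sup>2 = (cmod x)\<^sup>2 + r\<^sup>2 - 2 * Re (x * cnj b)"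
      unfolding r[symmetric] cmod_power2 by (simp add: power2_eq_square algebra_simps)
    moreover have "cmod (x - b) = l \<longleftrightarrow> (cmod (x - b))\<^sup>2 = l\<^sup>2"
      using assms(4) by (simp add: power2_eq_iff_nonneg)
    moreover have "Re (x / b) = Re (x * cnj b) / r\<^sup>2"
      by (simp add: complex_div_cnj[of x b] r)
    moreover have "cmod (x / b) = s / r \<longleftrightarrow> cmod x = s"
      using assms(2) by (simp add: norm_divide r)
    ultimately show ?thesis
      using assms(2) unfolding X x_def[symmetric] by (auto simp: field_simps)
  qed
  then have S: "S = {X. Re ((cpx X - cpx Z) / b) = ?k / (2 * r\<^sup>2) \<and> cmod ((cpx X - cpx Z) / b) = s / r}"
    unfolding S_def by blast
  have "s / r > 0" using assms by simp
  note * = chord_points[OF b this, where a = "cpx Z" and \<kappa> = "?k / (2 * r\<^sup>2)", folded S]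
  have scale: "s / r = 2 * r * s / (2 * r\<^sup>2)" "\<bar>?k / (2 * r\<^sup>2)\<bar> = \<bar>?k\<bar> / (2 * r\<^sup>2)"
    using assms by (simp_all add: power2_eq_square)
  have "0 < 2 * r\<^sup>2" using assms by simp
  then have "s / r < \<bar>?k / (2 * r\<^sup>2)\<bar> \<longleftrightarrow> 2 * r * s < \<bar>?k\<bar>" "s / r = \<bar>?k / (2 * r\<^sup>2)\<bar> \<longleftrightarrow> 2 * r * s = \<bar>?k\<bar>"
    "\<bar>?k / (2 * r\<^sup>2)\<bar> < s / r \<longleftrightarrow> \<bar>?k\<bar> < 2 * r * s"
    unfolding scale divide_less_cancel divide_cancel_right by auto
  with * show "2 * r * s < \<bar>?k\<bar> \<Longrightarrow> S = {}" "2 * r * s = \<bar>?k\<bar> \<Longrightarrow> card S = 1"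
    "\<bar>?k\<bar> < 2 * r * s \<Longrightarrow> card S = 2"
    by simp_all
qed

text \<open>The normalisation sends \<open>A\<close> to \<open>0\<close> and the direction of \<open>BD\<close> to the imaginary axis;
  \<open>h\<close> is the distance of \<open>A\<close> from the line \<open>BD\<close>.\<close>

lemma line_intersection_count:
  fixes A B D :: "real^2"
  assumes "B \<noteq> D" "l > 0"
  defines "S \<equiv> {X \<in> line B D. dist A X = l}"
    and "h \<equiv> \<bar>Im ((cpx B - cpx A) / (cpx D - cpx B))\<bar> * dist B D"
  shows "l < h \<Longrightarrow> S = {}" "l = h \<Longrightarrow> card S = 1" "h < l \<Longrightarrow> card S = 2"
proof -
  define u where "u = cpx D - cpx B"
  let ?h = "Im ((cpx B - cpx A) / u)"
  have u: "u \<noteq> 0" "cmod u = dist B D" using assms by (simp_all add: u_def cmod_cpx_diff dist_commute)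
  have "X \<in> line B D \<and> dist A X = l \<longleftrightarrow>
     Re ((cpx X - cpx A) / (\<i> * u)) = ?h \<and> cmod ((cpx X - cpx A) / (\<i> * u)) = l / dist B D" for X
  proof -
    have "X \<in> line B D \<longleftrightarrow> Im ((cpx X - cpx B) / u) = 0"
      using u assms(1) by (simp add: mem_line_iff[OF assms(1)] complex_div_cnj[of _ u] flip: u_def)
    also have "\<dots> \<longleftrightarrow> Im ((cpx X - cpx A) / u) = ?h"
      by (simp add: diff_divide_distrib)
    also have "Im ((cpx X - cpx A) / u) = Re ((cpx X - cpx A) / (\<i> * u))"
    proof -
      have "(cpx X - cpx A) / (\<i> * u) = - \<i> * ((cpx X - cpx A) / u)"
        using u by (simp add: field_simps)
      moreover have "Re (- \<i> * z) = Im z" for z by simp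
      ultimately show ?thesis by (simp only:)
    qed
    finally show ?thesis
      using assms(1) u by (simp add: norm_divide norm_mult) (simp add: cmod_cpx_diff dist_commute)
  qed
  then have S: "S = {X. Re ((cpx X - cpx A) / (\<i> * u)) = ?h \<and> cmod ((cpx X - cpx A) / (\<i> * u)) = l / dist B D}"
    unfolding S_def by blast
  have "\<i> * u \<noteq> 0" "l / dist B D > 0" using assms u by simp_all
  note * = chord_points[OF this, where a = "cpx A" and \<kappa> = ?h, folded S]
  have "dist B D > 0" using assms by simp
  then show "l < h \<Longrightarrow> S = {}" "l = h \<Longrightarrow> card S = 1" "h < l \<Longrightarrow> card S = 2"
    using * unfolding h_def u_def[symmetric] by (simp_all add: field_simps)
qed

text \<open>Dividing by \<open>D - B\<close> makes both lines horizontal; the imaginary part measures the gap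
  between them, and the foot of the perpendicular from \<open>A\<close> attains it.\<close>

lemma setdist_parallel_diagonals:
  assumes "A \<noteq> C" "B \<noteq> D" "parallel_diagonals A B C D"
  shows "setdist (line A C) (line B D) = \<bar>Im ((cpx B - cpx A) / (cpx D - cpx B))\<bar> * dist B D"
proof -
  define u where "u = cpx D - cpx B"
  have u: "u \<noteq> 0" "cmod u = dist B D" using assms by (simp_all add: u_def cmod_cpx_diff dist_commute)
  have "Im (u * cnj (cpx C - cpx A)) = 0" using assms parallel_diagonals_iff u_def by metis
  then have CA: "Im ((cpx C - cpx A) / u) = 0"
    using u by (simp add: complex_div_cnj[of _ u] algebra_simps)
  let ?t = "Re ((cpx B - cpx A) / u)"
  let ?Y = "B + (- ?t) *\<^sub>R (D - B)"
  have Y: "(cpx ?Y - cpx A) / u = \<i> * Im ((cpx B - cpx A) / u)"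
  proof -
    have "(cpx ?Y - cpx A) / u = (cpx B - cpx A) / u - of_real ?t"
      unfolding cpx_linear u_def[symmetric] using u(1) by (simp add: field_simps)
    also have "\<dots> = \<i> * Im ((cpx B - cpx A) / u)"
      by (simp only: complex_eq_iff) simp
    finally show ?thesis .
  qed
  have "dist A ?Y = cmod ((cpx ?Y - cpx A) / u * u)"
    using u by (simp add: cmod_cpx_diff dist_commute)
  then have Y_dist: "dist A ?Y = \<bar>Im ((cpx B - cpx A) / u)\<bar> * dist B D"
    unfolding Y norm_mult u(2) by simp
  have "setdist (line A C) (line B D) = dist A ?Y"
  proof (rule setdist_unique)
    show "A \<in> line A C" by (simp add: line_def hull_inc)
    show "?Y \<in> line B D" unfolding line_altdef by blast
  next
    fix x y assume "x \<in> line A C \<and> y \<in> line B D"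
    then obtain s t where st: "x = A + s *\<^sub>R (C - A)" "y = B + t *\<^sub>R (D - B)"
      unfolding line_altdef by auto
    have "cpx y - cpx x = (cpx B - cpx A) + of_real t * u - of_real s * (cpx C - cpx A)"
      by (simp add: st cpx_linear u_def)
    moreover have "(b + of_real t * u - of_real s * c) / u = b / u + of_real t - of_real s * (c / u)" for b c
      using u(1) by (simp add: field_simps)
    ultimately have "(cpx y - cpx x) / u = (cpx B - cpx A) / u + of_real t - of_real s * ((cpx C - cpx A) / u)"
      by (simp only:)
    then have "Im ((cpx y - cpx x) / u) = Im ((cpx B - cpx A) / u)"
      using CA by (simp del: times_divide_eq_right)
    then have "\<bar>Im ((cpx B - cpx A) / u)\<bar> \<le> cmod ((cpx y - cpx x) / u)"
      by (metis abs_Im_le_cmod)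
    then have "\<bar>Im ((cpx B - cpx A) / u)\<bar> * cmod u \<le> cmod (cpx y - cpx x)"
      using u(1) by (simp add: norm_divide pos_le_divide_eq)
    then show "dist A ?Y \<le> dist x y"
      unfolding Y_dist by (simp add: u cmod_cpx_diff dist_commute)
  qed
  then show ?thesis unfolding Y_dist unfolding u_def .
qed


section \<open>The bicycle correspondence of a quadrilateral\<close>

lemma dist_transport:
  assumes "dist P X = l" "l \<noteq> dist P Q"
  shows "X \<noteq> Q" "dist Q (transport P Q X) = l"
proof -
  show "X \<noteq> Q" using assms by auto
  then have "dist (cpx Q) (cpx (transport P Q X)) = dist (cpx X) (cpx P)"
    using dist_mirror[of "cpx X" "cpx Q" "cpx X" "cpx P"] by (simp add: cpx_transport del: dist_cpx)
  then show "dist Q (transport P Q X) = l"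
    using assms by (simp add: dist_commute)
qed

locale bicycle_setting =
  fixes A B C D :: "real^2" and l :: real
  assumes quad: "quadrilateral A B C D"
    and l: "l > 0"
    and sides: "l \<noteq> dist A B" "l \<noteq> dist B C" "l \<noteq> dist C D" "l \<noteq> dist D A"
begin

lemma vertices: "A \<noteq> B" "A \<noteq> C" "A \<noteq> D" "B \<noteq> C" "B \<noteq> D" "C \<noteq> D"
  using quad by (auto simp: quadrilateral_def)

lemma transport_chain:
  assumes "dist A A' = l" "transports_along A B C D A' B' C' D'"
  shows "bicycle_chain (cpx A) (cpx B) (cpx C) (cpx D) (cpx A') (cpx B') (cpx C') (cpx D') l"
    and "cpx (transport D A D') = mirror (cpx D') (cpx A) (cpx D)"
proof -
  have steps: "B' = transport A B A'" "C' = transport B C B'" "D' = transport C D C'"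
    using assms(2) by (auto simp: transports_along_def)
  have B': "A' \<noteq> B" "dist B B' = l" using dist_transport[OF assms(1) sides(1)] by (simp_all add: steps(1))
  have C': "B' \<noteq> C" "dist C C' = l" using dist_transport[OF B'(2) sides(2)] by (simp_all add: steps(2))
  have D': "C' \<noteq> D" "dist D D' = l" using dist_transport[OF C'(2) sides(3)] by (simp_all add: steps(3))
  have A'': "D' \<noteq> A" using dist_transport[OF D'(2) sides(4)] by simp
  show "bicycle_chain (cpx A) (cpx B) (cpx C) (cpx D) (cpx A') (cpx B') (cpx C') (cpx D') l"
    using l sides assms(1) vertices B' C' D' cpx_transport[of A' B A] cpx_transport[of B' C B]
      cpx_transport[of C' D C] by unfold_locales (simp_all flip: steps)
  show "cpx (transport D A D') = mirror (cpx D') (cpx A) (cpx D)"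
    using A'' by (rule cpx_transport)
qed

lemma parallel_diagonals_iff_mirror_factor:
  "parallel_diagonals A B C D
    \<longleftrightarrow> mirror_factor (cpx B) (cpx D) = mirror_factor (cpx A) (cpx C)"
  using vertices mirror_factor_eq_iff[of "cpx B" "cpx D" "cpx A" "cpx C"]
  by (simp add: parallel_diagonals_iff)

lemma correspondence_imp_quadrilateral:
  assumes "bicycle_correspondence l A B C D A' B' C' D'"
  shows "quadrilateral A' B' C' D'"
proof -
  have dist: "dist A A' = l" and steps: "transports_along A B C D A' B' C' D'"
    and closed: "transport D A D' = A'"
    using assms by (auto simp: bicycle_correspondence_def)
  show ?thesis
    using bicycle_chain.closed_imp_distinct[OF transport_chain(1)[OF dist steps]] closed
      transport_chain(2)[OF dist steps] by (simp add: quadrilateral_def)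
qed

lemma correspondence_if_concentric:
  assumes "dist A A' = l" "transports_along A B C D A' B' C' D'"
    and "dist Z A = dist Z C" "dist Z B = dist Z D" "dist Z A' = dist Z B"
  shows "bicycle_correspondence l A B C D A' B' C' D'"
    "dist Z B' = dist Z A" "dist Z C' = dist Z B" "dist Z D' = dist Z A"
  using bicycle_chain.closed_if_concentric[OF transport_chain(1)[OF assms(1,2)], of "cpx Z"]
    transport_chain(2)[OF assms(1,2)] assms
  by (simp_all add: bicycle_correspondence_def flip: cpx_eq_iff)

lemma correspondence_if_parallel:
  assumes "dist A A' = l" "transports_along A B C D A' B' C' D'"
    and "parallel_diagonals A B C D" "A' \<in> line B D"
  shows "bicycle_correspondence l A B C D A' B' C' D'"
    "B' \<in> line A C" "C' \<in> line B D" "D' \<in> line A C"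
proof -
  interpret chain: bicycle_chain "cpx A" "cpx B" "cpx C" "cpx D" "cpx A'" "cpx B'" "cpx C'" "cpx D'" l
    by (rule transport_chain(1)[OF assms(1,2)])
  have "mirror_factor (cpx A) (cpx C) = mirror_factor (cpx B) (cpx D)"
    using assms(3) by (simp add: parallel_diagonals_iff_mirror_factor)
  moreover have "mirror_factor (cpx B) (cpx A') = mirror_factor (cpx B) (cpx D)"
    using assms(4) vertices chain.A'_noteq_B by (simp add: mem_line_iff_mirror_factor)
  ultimately have "mirror_factor (cpx A') (cpx B) = mirror_factor (cpx A) (cpx C)"
     "mirror_factor (cpx B) (cpx D) = mirror_factor (cpx A) (cpx C)"
    by (simp_all add: mirror_factor_commute)
  note * = chain.closed_if_parallel[OF this]
  show "bicycle_correspondence l A B C D A' B' C' D'"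
    using * assms transport_chain(2)[OF assms(1,2)]
    by (simp add: bicycle_correspondence_def flip: cpx_eq_iff)
  show "B' \<in> line A C" "C' \<in> line B D" "D' \<in> line A C"
    using * vertices by (simp_all only: mem_line_iff not_False_eq_True)
qed

lemma circle1_circle2_positive:
  assumes "dist Z A = dist Z C" "dist Z B = dist Z D"
  shows "dist Z A > 0" "dist Z B > 0"
  using assms vertices by auto

lemma correspondence_if_circle2:
  assumes "dist A A' = l" "transports_along A B C D A' B' C' D'" "A' \<in> circle2 A B C D"
  shows "bicycle_correspondence l A B C D A' B' C' D'"
    and "C' \<in> circle2 A B C D" "B' \<in> circle1 A B C D" "D' \<in> circle1 A B C D"
proof -
  let ?g = "bicycle_correspondence l A B C D A' B' C' D' \<and>
    C' \<in> circle2 A B C D \<and> B' \<in> circle1 A B C D \<and> D' \<in> circle1 A B C D"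
  have ?g
  proof (cases "parallel_diagonals A B C D")
    case True
    then show ?thesis
      using correspondence_if_parallel[OF assms(1,2)] assms(3) by (simp add: circle1_def circle2_def)
  next
    case False
    then show ?thesis
      using correspondence_if_concentric[OF assms(1,2) center_equidistant[OF quad False]] assms(3)
      by (simp add: circle1_def circle2_def radius1_def radius2_def)
  qed
  then show "bicycle_correspondence l A B C D A' B' C' D'"
    and "C' \<in> circle2 A B C D" "B' \<in> circle1 A B C D" "D' \<in> circle1 A B C D" by blast+
qed

lemma circle2_if_correspondence:
  assumes "\<not> darboux_butterfly A B C D" "bicycle_correspondence l A B C D A' B' C' D'"
  shows "A' \<in> circle2 A B C D"
proof -
  have steps: "dist A A' = l" "transports_along A B C D A' B' C' D'"
    and closed: "transport D A D' = A'"
    using assms(2) by (auto simp: bicycle_correspondence_def)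
  interpret chain: bicycle_chain "cpx A" "cpx B" "cpx C" "cpx D" "cpx A'" "cpx B'" "cpx C'" "cpx D'" l
    by (rule transport_chain(1)[OF steps])
  have "chain.end_point = cpx A'" using transport_chain(2)[OF steps] closed by simp
  from chain.closed_concurrent_or_parallel[OF this] show ?thesis
  proof (elim disjE exE conjE)
    fix z assume z: "dist z (cpx A) = dist z (cpx C)" "dist z (cpx B) = dist z (cpx D)"
      "dist z (cpx A') = dist z (cpx B)"
    obtain Z where Z: "z = cpx Z" using surj_cpx by metis
    \<comment> \<open>With parallel diagonals, the reflections interchanging \<open>A, C\<close> and \<open>B, D\<close> would have
      equal factors and the common fixed point \<open>z\<close>, hence be equal: a butterfly.\<close>
    have "\<not> parallel_diagonals A B C D"
    proof
      assume "parallel_diagonals A B C D"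
      then have "mirror_factor (cpx B) (cpx D) = mirror_factor (cpx A) (cpx C)"
        by (simp add: parallel_diagonals_iff_mirror_factor)
      moreover have "mirror (cpx A) (cpx C) z = z" "mirror (cpx B) (cpx D) z = z"
        using z vertices by (simp_all add: mirror_fixed_iff)
      ultimately have "mirror (cpx A) (cpx C) (cpx B) = mirror (cpx B) (cpx D) (cpx B)"
        using mirror_diff[of "cpx A" "cpx C" "cpx B" z] mirror_diff[of "cpx B" "cpx D" "cpx B" z]
        by (metis diff_add_cancel)
      then show False using assms(1) vertices by (simp add: darboux_butterfly_iff)
    qed
    moreover from this have "center A B C D = Z"
      using z by (intro center_eqI quad) (simp_all add: Z)
    ultimately show ?thesis using z by (simp add: circle2_def radius2_def Z)
  next
    assume *: "mirror_factor (cpx A') (cpx B) = mirror_factor (cpx A) (cpx C)"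
      "mirror_factor (cpx B) (cpx D) = mirror_factor (cpx A) (cpx C)"
    then have "mirror_factor (cpx B) (cpx A') = mirror_factor (cpx B) (cpx D)"
      by (simp add: mirror_factor_commute)
    then have "A' \<in> line B D"
      using chain.A'_noteq_B vertices by (simp add: mem_line_iff_mirror_factor)
    then show ?thesis using * by (simp add: circle2_def parallel_diagonals_iff_mirror_factor)
  qed
qed

text \<open>Here \<open>mirror A C\<close> also interchanges \<open>B\<close> and \<open>D\<close>. Any point \<open>Z\<close> of its axis has \<open>ZA = ZC\<close> and
  \<open>ZB = ZD\<close>, which leaves only \<open>ZA' = ZB\<close> to arrange: \<open>Z\<close> is taken on the perpendicular bisector
  of \<open>A'B\<close>. When the two axes are parallel, \<open>A'\<close> lies on \<open>BD\<close> and the two diagonals serve instead.\<close>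

lemma butterfly_circles:
  assumes "darboux_butterfly A B C D" "dist A A' = l"
  shows "\<exists>C1 C2. concentric_or_parallel C1 C2 \<and> A \<in> C1 \<and> C \<in> C1 \<and> B \<in> C2 \<and> D \<in> C2 \<and> A' \<in> C2 \<and>
    (\<forall>B' C' D'. transports_along A B C D A' B' C' D' \<longrightarrow>
      bicycle_correspondence l A B C D A' B' C' D' \<and> quadrilateral A' B' C' D' \<and>
      C' \<in> C2 \<and> B' \<in> C1 \<and> D' \<in> C1)"
proof -
  have BD: "mirror (cpx A) (cpx C) (cpx B) = cpx D"
    using assms(1) vertices by (simp add: darboux_butterfly_iff)
  have A'B: "A' \<noteq> B" using assms(2) sides by auto
  show ?thesis
  proof (cases "mirror_factor (cpx A') (cpx B) = mirror_factor (cpx A) (cpx C)")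
    case True
    have eq: "mirror_factor (cpx B) (cpx D) = mirror_factor (cpx A) (cpx C)"
      using BD vertices mirror_factor_displacement[of "cpx A" "cpx C" "cpx B"] by simp
    then have par: "parallel_diagonals A B C D"
      by (simp add: parallel_diagonals_iff_mirror_factor)
    have "mirror_factor (cpx B) (cpx A') = mirror_factor (cpx B) (cpx D)"
      using True eq by (simp add: mirror_factor_commute)
    then have "A' \<in> line B D"
      using A'B vertices by (simp add: mem_line_iff_mirror_factor)
    moreover have "concentric_or_parallel (line A C) (line B D)"
      using par vertices by (simp add: concentric_or_parallel_def is_line_line parallel_diagonals_def)
    moreover have "A \<in> line A C" "C \<in> line A C" "B \<in> line B D" "D \<in> line B D"
      by (simp_all add: line_def hull_inc)
    ultimately show ?thesis
      using correspondence_if_parallel[OF assms(2) _ par] correspondence_imp_quadrilateral by blast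
  next
    case False
    then obtain z where z: "mirror (cpx A') (cpx B) z = z" "mirror (cpx A) (cpx C) z = z"
      using mirrors_meet A'B vertices cpx_eq_iff by metis
    obtain Z where Z: "z = cpx Z" using surj_cpx by metis
    have eqs: "dist Z A = dist Z C" "dist Z A' = dist Z B"
      using z A'B vertices by (simp_all add: mirror_fixed_iff Z)
    have eqs': "dist Z B = dist Z D"
      using dist_mirror[of "cpx A" "cpx C" z "cpx B"] vertices by (simp add: z BD) (simp add: Z)
    let ?C1 = "sphere Z (dist Z A)" and ?C2 = "sphere Z (dist Z B)"
    have "concentric_or_parallel ?C1 ?C2"
      using circle1_circle2_positive[OF eqs(1) eqs'] unfolding concentric_or_parallel_def by blast
    then show ?thesis
      using correspondence_if_concentric[OF assms(2) _ eqs(1) eqs' eqs(2)]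
        correspondence_imp_quadrilateral eqs eqs'
      by (intro exI[of _ ?C1] exI[of _ ?C2]) auto
  qed
qed

text \<open>These are the points \<open>A'\<close> from which the transport closes up; they correspond to the fixed
  directions \<open>u = (A' - A) / l\<close> of the monodromy.\<close>

definition closing_points :: "(real^2) set" where
  "closing_points = {X. dist A X = l \<and>
     transport D A (transport C D (transport B C (transport A B X))) = X}"

lemma bicycle_correspondence_iff:
  "bicycle_correspondence l A B C D A' B' C' D' \<longleftrightarrow>
    A' \<in> closing_points \<and> transports_along A B C D A' B' C' D'"
  by (auto simp: bicycle_correspondence_def closing_points_def transports_along_def)

lemma closing_points_eq:
  assumes "\<not> darboux_butterfly A B C D"
  shows "closing_points = {X \<in> circle2 A B C D. dist A X = l}"
  using circle2_if_correspondence[OF assms] correspondence_if_circle2(1)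
  unfolding bicycle_correspondence_iff transports_along_def closing_points_def by blast

lemma monodromy_eq_transport:
  assumes "norm u = 1"
  shows "A + l *\<^sub>R monodromy l A B C D u
    = transport D A (transport C D (transport B C (transport A B (A + l *\<^sub>R u))))"
proof -
  have step: "transport P Q (P + l *\<^sub>R v) = Q + l *\<^sub>R bicycle_map l P Q v \<and> norm (bicycle_map l P Q v) = 1"
    if "norm v = 1" "l \<noteq> dist P Q" for P Q v
  proof -
    have d: "dist P (P + l *\<^sub>R v) = l" using that l by (simp add: dist_norm)
    have eq: "transport P Q (P + l *\<^sub>R v) = Q + l *\<^sub>R bicycle_map l P Q v"
      using transport_eq_bicycle_map[OF d l that(2)[symmetric]] l by simp
    have "dist Q (transport P Q (P + l *\<^sub>R v)) = l"
      using dist_transport[OF d that(2)] by blast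
    then show ?thesis using l unfolding eq by (simp add: dist_norm)
  qed
  show ?thesis using step sides assms by (simp add: monodromy_def)
qed

lemma circle_fixpoints_monodromy:
  "(\<lambda>u. A + l *\<^sub>R u) ` circle_fixpoints (monodromy l A B C D) = closing_points"
proof -
  have *: "A + l *\<^sub>R u \<in> closing_points \<longleftrightarrow> u \<in> circle_fixpoints (monodromy l A B C D)" for u
  proof -
    have "dist A (A + l *\<^sub>R u) = l \<longleftrightarrow> norm u = 1" using l by (simp add: dist_norm)
    then show ?thesis
      using monodromy_eq_transport[of u] l
      by (auto simp: closing_points_def circle_fixpoints_def simp flip: monodromy_eq_transport)
  qed
  show ?thesis
  proof (intro equalityI subsetI)
    fix X assume "X \<in> closing_points"
    moreover have "X = A + l *\<^sub>R ((X - A) /\<^sub>R l)" using l by simp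
    ultimately show "X \<in> (\<lambda>u. A + l *\<^sub>R u) ` circle_fixpoints (monodromy l A B C D)"
      using * by (metis imageI)
  qed (use * in auto)
qed

lemma monodromy_types:
  "elliptic (monodromy l A B C D) \<longleftrightarrow> closing_points = {}"
  "parabolic (monodromy l A B C D) \<longleftrightarrow> card closing_points = 1"
  "hyperbolic (monodromy l A B C D) \<longleftrightarrow> card closing_points = 2"
proof -
  have "inj_on (\<lambda>u. A + l *\<^sub>R u) S" for S using l by (auto simp: inj_on_def)
  then have "card closing_points = card (circle_fixpoints (monodromy l A B C D))"
    using card_image circle_fixpoints_monodromy by metis
  then show
    "elliptic (monodromy l A B C D) \<longleftrightarrow> closing_points = {}"
    "parabolic (monodromy l A B C D) \<longleftrightarrow> card closing_points = 1"
    "hyperbolic (monodromy l A B C D) \<longleftrightarrow> card closing_points = 2"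
    unfolding elliptic_def parabolic_def hyperbolic_def circle_fixpoints_monodromy[symmetric] by auto
qed

lemma butterfly_monodromy:
  assumes "darboux_butterfly A B C D" "u \<in> sphere 0 1"
  shows "monodromy l A B C D u = u"
proof -
  have u: "norm u = 1" using assms(2) by simp
  have "dist A (A + l *\<^sub>R u) = l" using l u by (simp add: dist_norm)
  from butterfly_circles[OF assms(1) this] have "A + l *\<^sub>R u \<in> closing_points"
    unfolding bicycle_correspondence_iff transports_along_def by blast
  then show ?thesis
    using monodromy_eq_transport[OF u] l by (simp add: closing_points_def)
qed

text \<open>For circles, write \<open>m = 2 * r * s\<close> and \<open>x = r\<^sup>2 + s\<^sup>2 - l\<^sup>2\<close>. The factorisations
  \<open>m - x = (l - (r - s)) * (l + (r - s))\<close> and \<open>m + x = (r + s - l) * (r + s + l)\<close> translate the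
  position of \<open>l\<close> relative to \<open>r - s\<close> and \<open>r + s\<close> into the comparison of \<open>\<bar>x\<bar>\<close> with \<open>m\<close>.\<close>

lemma closing_points_count:
  assumes "\<not> darboux_butterfly A B C D"
    and "\<not> parallel_diagonals A B C D \<Longrightarrow> radius2 A B C D \<le> radius1 A B C D"
  shows "ereal l < radius_diff A B C D \<or> radius_sum A B C D < ereal l \<Longrightarrow> closing_points = {}"
    "radius_diff A B C D < ereal l \<Longrightarrow> ereal l < radius_sum A B C D \<Longrightarrow> card closing_points = 2"
    "ereal l = radius_diff A B C D \<or> ereal l = radius_sum A B C D \<Longrightarrow> card closing_points = 1"
proof -
  let ?g = "(ereal l < radius_diff A B C D \<or> radius_sum A B C D < ereal l \<longrightarrow> closing_points = {}) \<and>
    (radius_diff A B C D < ereal l \<and> ereal l < radius_sum A B C D \<longrightarrow> card closing_points = 2) \<and>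
    (ereal l = radius_diff A B C D \<or> ereal l = radius_sum A B C D \<longrightarrow> card closing_points = 1)"
  have ?g
  proof (cases "parallel_diagonals A B C D")
    case True
    have "closing_points = {X \<in> line B D. dist A X = l}"
      using closing_points_eq[OF assms(1)] True by (simp add: circle2_def)
    note * = line_intersection_count[OF vertices(5) l, of A, folded this]
    show ?thesis
      using * True vertices
      by (simp add: radius_diff_def radius_sum_def setdist_parallel_diagonals)
  next
    case False
    define Z r s where "Z = center A B C D" and "r = radius1 A B C D" and "s = radius2 A B C D"
    have r: "dist Z A = r" "r > 0" and s: "dist Z B = s" "s > 0"
      using circle1_circle2_positive[OF center_equidistant[OF quad False]]
      by (simp_all add: r_def s_def Z_def radius1_def radius2_def)
    have "s \<le> r" using assms(2) False by (simp add: r_def s_def)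
    have "closing_points = {X. dist Z X = s \<and> dist A X = l}"
      using closing_points_eq[OF assms(1)] False by (auto simp: circle2_def Z_def s_def)
    note * = circle_intersection_count[OF r s(2) l, folded this]
    define m x where "m = 2 * r * s" and "x = r\<^sup>2 + s\<^sup>2 - l\<^sup>2"
    have "m - x = (l - (r - s)) * (l + (r - s))" and "m + x = (r + s - l) * (r + s + l)"
      by (simp_all add: m_def x_def power2_eq_square algebra_simps)
    moreover have "0 < l + (r - s)" "0 < r + s + l" using l r s \<open>s \<le> r\<close> by auto
    ultimately have signs: "0 < m - x \<longleftrightarrow> r - s < l" "m - x = 0 \<longleftrightarrow> l = r - s"
      "0 < m + x \<longleftrightarrow> l < r + s" "m + x = 0 \<longleftrightarrow> l = r + s"
      by (simp_all add: zero_less_mult_iff) linarith+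
    have "m > 0" using r s by (simp add: m_def)
    then have "l < r - s \<or> r + s < l \<longrightarrow> m < \<bar>x\<bar>" "r - s < l \<and> l < r + s \<longrightarrow> \<bar>x\<bar> < m"
      "l = r - s \<or> l = r + s \<longrightarrow> m = \<bar>x\<bar>"
      using signs by argo+
    moreover note *[folded m_def x_def]
    ultimately show ?thesis
      using False by (auto simp: radius_diff_def radius_sum_def simp flip: r_def s_def)
  qed
  then show "ereal l < radius_diff A B C D \<or> radius_sum A B C D < ereal l \<Longrightarrow> closing_points = {}"
    "radius_diff A B C D < ereal l \<Longrightarrow> ereal l < radius_sum A B C D \<Longrightarrow> card closing_points = 2"
    "ereal l = radius_diff A B C D \<or> ereal l = radius_sum A B C D \<Longrightarrow> card closing_points = 1"
    by blast+
qed

lemma closing_points_nonempty: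
  assumes "\<not> darboux_butterfly A B C D"
    and "\<not> parallel_diagonals A B C D \<Longrightarrow> radius2 A B C D \<le> radius1 A B C D"
    and "radius_diff A B C D \<le> ereal l" "ereal l \<le> radius_sum A B C D"
  shows "closing_points \<noteq> {}"
proof -
  have "card closing_points \<noteq> 0"
    using closing_points_count(2,3)[OF assms(1,2)] assms(3,4) by (auto simp: order.order_iff_strict)
  then show ?thesis by auto
qed

end

theorem theorem8:
  fixes A B C D :: "real^2" and l :: real
  assumes "quadrilateral A B C D"
    and "l > 0"
    and "l \<noteq> dist A B" "l \<noteq> dist B C" "l \<noteq> dist C D" "l \<noteq> dist D A"
  shows
   "(\<not> darboux_butterfly A B C D \<longrightarrow>
     (\<not> parallel_diagonals A B C D \<longrightarrow> radius2 A B C D \<le> radius1 A B C D) \<longrightarrow>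
       (ereal l < radius_diff A B C D \<or> radius_sum A B C D < ereal l
          \<longrightarrow> elliptic (monodromy l A B C D))
     \<and> (radius_diff A B C D < ereal l \<and> ereal l < radius_sum A B C D
          \<longrightarrow> hyperbolic (monodromy l A B C D))
     \<and> (ereal l = radius_diff A B C D \<or> ereal l = radius_sum A B C D
          \<longrightarrow> parabolic (monodromy l A B C D))
     \<and> (radius_diff A B C D \<le> ereal l \<and> ereal l \<le> radius_sum A B C D \<longrightarrow>
          (\<exists>A'\<in>circle2 A B C D. dist A A' = l) \<and>
          (\<forall>A' B' C' D'.
             (bicycle_correspondence l A B C D A' B' C' D' \<longleftrightarrow>
                A' \<in> circle2 A B C D \<and> dist A A' = l \<and> transports_along A B C D A' B' C' D') \<and>
             (bicycle_correspondence l A B C D A' B' C' D' \<longrightarrow>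
                quadrilateral A' B' C' D' \<and>
                A' \<in> circle2 A B C D \<and> C' \<in> circle2 A B C D \<and>
                B' \<in> circle1 A B C D \<and> D' \<in> circle1 A B C D))))
  \<and> (darboux_butterfly A B C D \<longrightarrow>
       (\<forall>u\<in>sphere 0 1. monodromy l A B C D u = u) \<and>
       (\<forall>A'. dist A A' = l \<longrightarrow>
          (\<exists>C1 C2. concentric_or_parallel C1 C2 \<and> A \<in> C1 \<and> C \<in> C1 \<and> B \<in> C2 \<and> D \<in> C2 \<and> A' \<in> C2 \<and>
             (\<forall>B' C' D'. transports_along A B C D A' B' C' D' \<longrightarrow>
                bicycle_correspondence l A B C D A' B' C' D' \<and> quadrilateral A' B' C' D' \<and>
                C' \<in> C2 \<and> B' \<in> C1 \<and> D' \<in> C1))))"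
proof -
  interpret bicycle_setting A B C D l
    using assms by unfold_locales
  show ?thesis
  proof (intro conjI impI allI ballI)
    assume nb: "\<not> darboux_butterfly A B C D"
      and "\<not> parallel_diagonals A B C D \<longrightarrow> radius2 A B C D \<le> radius1 A B C D"
    then have ord: "\<not> parallel_diagonals A B C D \<Longrightarrow> radius2 A B C D \<le> radius1 A B C D" by blast
    note count = closing_points_count[OF nb ord]
    show "elliptic (monodromy l A B C D)"
      if "ereal l < radius_diff A B C D \<or> radius_sum A B C D < ereal l"
      using count(1) that by (simp add: monodromy_types)
    show "hyperbolic (monodromy l A B C D)"
      if "radius_diff A B C D < ereal l \<and> ereal l < radius_sum A B C D"
      using count(2) that by (simp add: monodromy_types)
    show "parabolic (monodromy l A B C D)"
      if "ereal l = radius_diff A B C D \<or> ereal l = radius_sum A B C D"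
      using count(3) that by (simp add: monodromy_types)
    note corr = bicycle_correspondence_iff[unfolded closing_points_eq[OF nb]]
    show "\<exists>A'\<in>circle2 A B C D. dist A A' = l"
      if "radius_diff A B C D \<le> ereal l \<and> ereal l \<le> radius_sum A B C D"
      using closing_points_nonempty[OF nb ord] that by (auto simp: closing_points_eq[OF nb])
    show "bicycle_correspondence l A B C D A' B' C' D' \<longleftrightarrow>
        A' \<in> circle2 A B C D \<and> dist A A' = l \<and> transports_along A B C D A' B' C' D'" for A' B' C' D'
      using corr by blast
    show "quadrilateral A' B' C' D'"
      "A' \<in> circle2 A B C D" "C' \<in> circle2 A B C D" "B' \<in> circle1 A B C D" "D' \<in> circle1 A B C D"
      if "bicycle_correspondence l A B C D A' B' C' D'" for A' B' C' D'
      using that correspondence_imp_quadrilateral[OF that] correspondence_if_circle2 corr by blast+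
  next
    assume b: "darboux_butterfly A B C D"
    show "monodromy l A B C D u = u" if "u \<in> sphere 0 1" for u
      using butterfly_monodromy[OF b that] .
    show "\<exists>C1 C2. concentric_or_parallel C1 C2 \<and> A \<in> C1 \<and> C \<in> C1 \<and> B \<in> C2 \<and> D \<in> C2 \<and> A' \<in> C2 \<and>
             (\<forall>B' C' D'. transports_along A B C D A' B' C' D' \<longrightarrow>
                bicycle_correspondence l A B C D A' B' C' D' \<and> quadrilateral A' B' C' D' \<and>
                C' \<in> C2 \<and> B' \<in> C1 \<and> D' \<in> C1)" if "dist A A' = l" for A'
      using butterfly_circles[OF b that] .
  qed
qed

end
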